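(* Let $S=[\mathbf{v}_0,\dots,\mathbf{v}_n]$ and $T=[\mathbf{w}_0,\dots,\mathbf{w}_m]$ be simplices in $\mathbb{R}^d$, of dimensions $n$ and $m$ (not both zero), with common vertices $\mathbf{v}_i=\mathbf{w}_i$ for $i\in\{0,\dots,k\}$, where $0\le k\le\min(n,m)$, and such that $S\cap T=[\mathbf{v}_0,\dots,\mathbf{v}_k]$. Then $S\times T$ has the following decomposition into iterated pyramids with nonsingular bases: $$S\times T=\bigcup_{\mathcal{I}\in\mathcal{P}(\{0,\dots,k\})}\mathrm{pyr}\big(\mathbf{v}_0\times\mathbf{v}_0,\dots,\mathbf{v}_k\times\mathbf{v}_k,\;S_{\mathcal{I}}\times T_{\mathcal{I}'}\big),\qquad \mathcal{I}'=\{0,\dots,k\}\setminus\mathcal{I}.$$ The number of nonempty iterated pyramids in this decomposition is $2^{k+1}-\sigma$, where $$\sigma=\begin{cases}2 & \text{if } n=m=k,\\ 1 & \text{if } n>k,\ m=k\ \text{ or }\ n=k,\ m>k,\\ 0 & \text{otherwise.}\end{cases}$$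
   Context: $[\cdots]$ denotes the convex hull of the listed points; $\mathcal{P}(\cdot)$ is the power set; $\mathbf{v}\times\mathbf{w}$ denotes the point $(\mathbf{v},\mathbf{w})\in\mathbb{R}^{2d}$. For an index set $\mathcal{I}$, $S_{\mathcal{I}}$ is the face of $S$ spanned by the vertices $\mathbf{v}_i$ with $i\in\{0,\dots,n\}\setminus\mathcal{I}$, and $T_{\mathcal{I}}$ is the face of $T$ spanned by the vertices $\mathbf{w}_i$ with $i\in\{0,\dots,m\}\setminus\mathcal{I}$ (the empty set if no vertices remain). For a polytope $B$ and a point $\mathbf{v}\notin\mathrm{aff}(B)$, $\mathrm{pyr}(\mathbf{v},B)=\{(1-\lambda)\mathbf{v}+\lambda\mathbf{x}:\mathbf{x}\in B,\ \lambda\in[0,1]\}$. The iterated pyramid $\mathrm{pyr}(\mathbf{u}_0,\dots,\mathbf{u}_k,B_k)$ is $\mathrm{pyr}(\mathbf{u}_0,B_0)$, where $B_{j-1}=\mathrm{pyr}(\mathbf{u}_j,B_j)$ for $1\le j\le k$, and it is required that $\mathbf{u}_j\notin\mathrm{aff}(B_j)$ for $0\le j\le k$. A pyramid with empty base (here $S_{\mathcal{I}}=\emptyset$ or $T_{\mathcal{I}'}=\emptyset$) is regarded as empty. The singular vertices of $S\times T$ are $(\mathbf{v}_i,\mathbf{v}_i)$, $i\in\{0,\dots,k\}$; a face is nonsingular if it contains none of them. A decomposition is a representation as a union of sets whose relative interiors are pairwise disjoint. *)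

theory Defs
  imports "HOL-Analysis.Analysis"
begin

(* The requirements on a pyramid (polytopal base, apex outside the affine hull of the base) are
   kept apart from the set itself, in is_iter_pyr below. pyr u {} = {} holds by definition. *)
definition pyr :: "'a::real_vector \<Rightarrow> 'a set \<Rightarrow> 'a set" where
  "pyr u B = {(1 - l) *\<^sub>R u + l *\<^sub>R x | x l. x \<in> B \<and> 0 \<le> l \<and> l \<le> 1}"

(* The head of the list is the outermost apex. *)
fun iter_pyr :: "'a::real_vector list \<Rightarrow> 'a set \<Rightarrow> 'a set" where
  "iter_pyr [] B = B"
| "iter_pyr (u # us) B = pyr u (iter_pyr us B)"

(* iter_pyr us B is a genuine iterated pyramid. The empty base is admitted, since
   affine hull {} = {} makes the apex conditions vacuous. *)
fun is_iter_pyr :: "'a::real_normed_vector list \<Rightarrow> 'a set \<Rightarrow> bool" where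
  "is_iter_pyr [] B \<longleftrightarrow> polytope B"
| "is_iter_pyr (u # us) B \<longleftrightarrow>
     is_iter_pyr us B \<and> polytope (iter_pyr us B) \<and> u \<notin> affine hull (iter_pyr us B)"

(* The face of [x 0, ..., x n] spanned by the vertices whose index is not in I. *)
definition opp_face :: "(nat \<Rightarrow> 'a::real_vector) \<Rightarrow> nat \<Rightarrow> nat set \<Rightarrow> 'a set" where
  "opp_face x n I = convex hull (x ` ({0..n} - I))"

definition singular_vertices :: "(nat \<Rightarrow> 'a) \<Rightarrow> nat \<Rightarrow> ('a \<times> 'a) set" where
  "singular_vertices x k = {(x i, x i) | i. i \<in> {0..k}}"

definition nonsingular_face :: "'a::real_vector set \<Rightarrow> 'a set \<Rightarrow> 'a set \<Rightarrow> bool" where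
  "nonsingular_face Z Q F \<longleftrightarrow> F face_of Q \<and> (\<forall>z\<in>Z. z \<notin> F)"

definition decomposition :: "'a::euclidean_space set \<Rightarrow> 'i set \<Rightarrow> ('i \<Rightarrow> 'a set) \<Rightarrow> bool" where
  "decomposition Q A P \<longleftrightarrow>
     Q = (\<Union>i\<in>A. P i) \<and> disjoint_family_on (\<lambda>i. rel_interior (P i)) A"

definition prod_piece ::
  "(nat \<Rightarrow> 'a::real_vector) \<Rightarrow> nat \<Rightarrow> (nat \<Rightarrow> 'a) \<Rightarrow> nat \<Rightarrow> nat \<Rightarrow> nat set \<Rightarrow> ('a \<times> 'a) set" where
  "prod_piece v n w m k I =
     iter_pyr (map (\<lambda>i. (v i, v i)) [0..<Suc k]) (opp_face v n I \<times> opp_face w m ({0..k} - I))"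

definition count_defect :: "nat \<Rightarrow> nat \<Rightarrow> nat \<Rightarrow> nat" where
  "count_defect n m k =
     (if n = k \<and> m = k then 2
      else if n > k \<and> m = k \<or> n = k \<and> m > k then 1
      else 0)"

end

theory Submission
  imports Defs
begin

text \<open>
  Write \<open>(x, y)\<close> in barycentric coordinates as \<open>x = \<Sum> a\<^sub>i v\<^sub>i\<close>, \<open>y = \<Sum> b\<^sub>i w\<^sub>i\<close>. A point of the
  iterated pyramid over \<open>S\<^sub>I \<times> T\<^sub>I\<^sub>'\<close> is \<open>\<Sum> c\<^sub>i (v\<^sub>i, v\<^sub>i) + r (p, q)\<close> with \<open>p\<^sub>i = 0\<close> on \<open>I\<close> and \<open>q\<^sub>i = 0\<close>
  on \<open>I'\<close>, so that \<open>c\<^sub>i = min a\<^sub>i b\<^sub>i\<close>. Hence a piece with nonempty base is the region cut out of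
  \<open>S \<times> T\<close> by \<open>a\<^sub>i \<le> b\<^sub>i\<close> for \<open>i \<in> I\<close> and \<open>b\<^sub>i \<le> a\<^sub>i\<close> for \<open>i \<in> I'\<close>, and in its relative interior all these
  inequalities are strict. The region of an index set with empty base lies in the diagonal
  \<open>a\<^sub>i = b\<^sub>i\<close> (\<open>i \<le> k\<close>) and is therefore contained in every nonempty piece.
\<close>

section \<open>Barycentric coordinates and faces of a simplex\<close>

text \<open>A relation, since coordinates are unique only for affinely independent vertices. Weights
  at indices beyond \<open>n\<close> are left unconstrained.\<close>

definition bary_coords :: "(nat \<Rightarrow> 'a::real_vector) \<Rightarrow> nat \<Rightarrow> 'a \<Rightarrow> (nat \<Rightarrow> real) \<Rightarrow> bool" where
  "bary_coords v n x a \<longleftrightarrow>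
     (\<forall>i\<in>{0..n}. 0 \<le> a i) \<and> sum a {0..n} = 1 \<and> (\<Sum>i=0..n. a i *\<^sub>R v i) = x"

lemma bary_coords_vertex:
  "j \<le> n \<Longrightarrow> bary_coords v n (v j) (\<lambda>i. if i = j then 1 else 0)"
  by (auto simp: bary_coords_def if_distrib [of "\<lambda>c. c *\<^sub>R _"] cong: if_cong)

lemma bary_coords_convex_combination:
  assumes "bary_coords v n x a" "bary_coords v n y b" "0 \<le> s" "0 \<le> t" "s + t = 1"
  shows "bary_coords v n (s *\<^sub>R x + t *\<^sub>R y) (\<lambda>i. s * a i + t * b i)"
proof -
  have "(\<Sum>i=0..n. (s * a i + t * b i) *\<^sub>R v i) =
      s *\<^sub>R (\<Sum>i=0..n. a i *\<^sub>R v i) + t *\<^sub>R (\<Sum>i=0..n. b i *\<^sub>R v i)"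
    by (simp add: scaleR_left_distrib sum.distrib scaleR_sum_right)
  moreover have "(\<Sum>i=0..n. s * a i + t * b i) = s * sum a {0..n} + t * sum b {0..n}"
    by (simp add: sum.distrib sum_distrib_left)
  ultimately show ?thesis
    using assms by (auto simp: bary_coords_def)
qed

lemma affine_independent_weights_eq_0:
  fixes v :: "nat \<Rightarrow> 'a::real_vector"
  assumes "inj_on v {0..n}" "\<not> affine_dependent (v ` {0..n})"
    and "sum c {0..n} = 0" "(\<Sum>i=0..n. c i *\<^sub>R v i) = 0" "j \<le> n"
  shows "c j = 0"
proof (rule ccontr)
  assume "c j \<noteq> 0"
  \<comment> \<open>Affine dependence is stated with weights on points, so the indexed weights are
    carried to the vertices through the inverse of \<open>v\<close>.\<close>
  define U where "U = (\<lambda>x. c (the_inv_into {0..n} v x))"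
  have U: "U (v i) = c i" if "i \<le> n" for i
    using the_inv_into_f_f [OF assms(1), of i] that by (simp add: U_def)
  have "sum U (v ` {0..n}) = 0"
    using assms(3) by (simp add: sum.reindex [OF assms(1)] U)
  moreover have "(\<Sum>x\<in>v ` {0..n}. U x *\<^sub>R x) = 0"
    using assms(4) by (simp add: sum.reindex [OF assms(1)] U)
  moreover have "U (v j) \<noteq> 0"
    using \<open>c j \<noteq> 0\<close> \<open>j \<le> n\<close> by (simp add: U)
  ultimately have "affine_dependent (v ` {0..n})"
    using \<open>j \<le> n\<close> unfolding affine_dependent_explicit_finite [OF finite_imageI [OF finite_atLeastAtMost]]
    by (intro exI [of _ U]) auto
  with assms(2) show False by contradiction
qed

lemma bary_coords_unique:
  assumes "inj_on v {0..n}" "\<not> affine_dependent (v ` {0..n})"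
    and "bary_coords v n x a" "bary_coords v n x b" "j \<le> n"
  shows "a j = b j"
proof -
  have "sum (\<lambda>i. a i - b i) {0..n} = 0" "(\<Sum>i=0..n. (a i - b i) *\<^sub>R v i) = 0"
    using assms(3,4) by (auto simp: bary_coords_def sum_subtractf scaleR_left_diff_distrib)
  from affine_independent_weights_eq_0 [OF assms(1,2) this assms(5)] show ?thesis by simp
qed

text \<open>From left to right: the points with such coordinates form a convex set containing the
  spanning vertices, hence their hull. Conversely, dropping the zero weights on \<open>I\<close>
  leaves a convex combination of the remaining vertices.\<close>

lemma mem_opp_face_iff:
  "x \<in> opp_face v n I \<longleftrightarrow> (\<exists>a. bary_coords v n x a \<and> (\<forall>i\<in>I. a i = 0))"
proof
  let ?C = "{x. \<exists>a. bary_coords v n x a \<and> (\<forall>i\<in>I. a i = 0)}"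
  have "convex ?C"
  proof (rule convexI)
    fix x y and s t :: real
    assume "x \<in> ?C" "y \<in> ?C" and st: "0 \<le> s" "0 \<le> t" "s + t = 1"
    then obtain a b where "bary_coords v n x a" "bary_coords v n y b"
      and "\<forall>i\<in>I. a i = 0" "\<forall>i\<in>I. b i = 0" by blast
    then show "s *\<^sub>R x + t *\<^sub>R y \<in> ?C"
      using bary_coords_convex_combination [OF _ _ st, of v n x a y b]
      by (auto intro!: exI [of _ "\<lambda>i. s * a i + t * b i"])
  qed
  moreover have "v ` ({0..n} - I) \<subseteq> ?C"
  proof clarsimp
    fix j assume "j \<le> n" "j \<notin> I"
    then show "\<exists>a. bary_coords v n (v j) a \<and> (\<forall>i\<in>I. a i = 0)"
      by (intro exI [of _ "\<lambda>i. if i = j then 1 else 0"]) (auto intro: bary_coords_vertex)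
  qed
  ultimately have "opp_face v n I \<subseteq> ?C"
    unfolding opp_face_def by (rule hull_minimal [rotated])
  then show "x \<in> opp_face v n I \<Longrightarrow> \<exists>a. bary_coords v n x a \<and> (\<forall>i\<in>I. a i = 0)"
    by blast
next
  assume "\<exists>a. bary_coords v n x a \<and> (\<forall>i\<in>I. a i = 0)"
  then obtain a where a: "bary_coords v n x a" "\<forall>i\<in>I. a i = 0" by blast
  have "(\<Sum>i\<in>{0..n} - I. a i) = (\<Sum>i=0..n. a i)"
    by (rule sum.mono_neutral_left) (use a in auto)
  then have "(\<Sum>i\<in>{0..n} - I. a i) = 1"
    using a by (simp add: bary_coords_def)
  moreover have "(\<Sum>i\<in>{0..n} - I. a i *\<^sub>R v i) = (\<Sum>i=0..n. a i *\<^sub>R v i)"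
    by (rule sum.mono_neutral_left) (use a in auto)
  moreover have "(\<Sum>i\<in>{0..n} - I. a i *\<^sub>R v i) \<in> opp_face v n I"
    unfolding opp_face_def
    by (rule convex_sum) (use a calculation in \<open>auto simp: bary_coords_def intro: hull_inc\<close>)
  ultimately show "x \<in> opp_face v n I"
    using a by (simp add: bary_coords_def)
qed

lemma opp_face_eq_empty_iff: "opp_face v n I = {} \<longleftrightarrow> {0..n} \<subseteq> I"
  by (auto simp: opp_face_def)

lemma convex_opp_face: "convex (opp_face v n I)"
  by (simp add: opp_face_def)

lemma polytope_opp_face: "polytope (opp_face v n I)"
  by (simp add: opp_face_def polytope_convex_hull)

text \<open>For \<open>sum d {0..n} = 0\<close> the point \<open>p\<close> is arbitrary, hence the nonemptiness assumption.\<close>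

lemma weights_scaled_opp_face:
  assumes "opp_face v n I \<noteq> {}" "\<And>i. i \<le> n \<Longrightarrow> 0 \<le> d i" "\<And>i. i \<in> I \<Longrightarrow> d i = 0"
  shows "\<exists>p\<in>opp_face v n I. (\<Sum>i=0..n. d i *\<^sub>R v i) = sum d {0..n} *\<^sub>R p"
proof (cases "sum d {0..n} = 0")
  case True
  then have "\<forall>i\<in>{0..n}. d i = 0"
    using assms(2) by (subst (asm) sum_nonneg_eq_0_iff) auto
  then show ?thesis
    using assms(1) True by auto
next
  case False
  let ?r = "sum d {0..n}"
  have "?r > 0"
    using False assms(2) by (metis atLeastAtMost_iff less_eq_real_def sum_nonneg)
  let ?p = "(\<Sum>i=0..n. (d i / ?r) *\<^sub>R v i)"
  have "bary_coords v n ?p (\<lambda>i. d i / ?r)"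
    using \<open>?r > 0\<close> assms(2) by (simp add: bary_coords_def flip: sum_divide_distrib)
  then have "?p \<in> opp_face v n I"
    using assms(3) by (auto simp: mem_opp_face_iff intro!: exI [of _ "\<lambda>i. d i / ?r"])
  moreover have "(\<Sum>i=0..n. d i *\<^sub>R v i) = ?r *\<^sub>R ?p"
    using False by (simp add: scaleR_sum_right)
  ultimately show ?thesis by blast
qed

section \<open>Iterated pyramids as convex hulls\<close>

lemma affine_Times: "affine A \<Longrightarrow> affine B \<Longrightarrow> affine (A \<times> B)"
  by (auto simp: affine_def)

text \<open>Nonemptiness matters: over the empty base the pyramid is empty, but the hull is
  \<open>{u}\<close>.\<close>

lemma pyr_eq_convex_hull:
  assumes "convex B" "B \<noteq> {}"
  shows "pyr u B = convex hull (insert u B)"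
proof -
  have "pyr u B = {x. \<exists>s\<ge>0. \<exists>t\<ge>0. \<exists>b. s + t = 1 \<and> b \<in> B \<and> x = s *\<^sub>R u + t *\<^sub>R b}"
    (is "_ = ?R")
  proof
    show "pyr u B \<subseteq> ?R"
    proof
      fix x assume "x \<in> pyr u B"
      then obtain b l where "x = (1 - l) *\<^sub>R u + l *\<^sub>R b" "b \<in> B" "0 \<le> l" "l \<le> 1"
        by (auto simp: pyr_def)
      moreover from this have "0 \<le> 1 - l" "(1 - l) + l = 1" by auto
      ultimately show "x \<in> ?R" by blast
    qed
    show "?R \<subseteq> pyr u B"
      by (auto simp: pyr_def) (metis add_diff_cancel_right' le_add_same_cancel2)
  qed
  then show ?thesis
    using assms by (simp add: convex_hull_insert hull_same)
qed

lemma iter_pyr_empty: "iter_pyr us {} = {}"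
  by (induction us) (auto simp: pyr_def)

lemma iter_pyr_eq_convex_hull:
  assumes "convex B" "B \<noteq> {}"
  shows "iter_pyr us B = convex hull (set us \<union> B)"
proof (induction us)
  case Nil
  then show ?case using assms by (simp add: hull_same)
next
  case (Cons u us)
  have "iter_pyr (u # us) B = convex hull (insert u (convex hull (set us \<union> B)))"
    using assms Cons by (simp add: pyr_eq_convex_hull)
  then show ?case
    by (simp flip: hull_insert)
qed

lemma convex_iter_pyr: "convex B \<Longrightarrow> convex (iter_pyr us B)"
  by (cases "B = {}") (simp_all add: iter_pyr_empty iter_pyr_eq_convex_hull)

lemma iter_pyr_subset:
  assumes "convex B" "convex C" "set us \<subseteq> C" "B \<subseteq> C"
  shows "iter_pyr us B \<subseteq> C"
proof (cases "B = {}")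
  case False
  then show ?thesis
    using assms by (simp add: iter_pyr_eq_convex_hull hull_minimal)
qed (simp add: iter_pyr_empty)

lemma polytope_iter_pyr:
  assumes "polytope B"
  shows "polytope (iter_pyr us B)"
proof (cases "B = {}")
  case False
  obtain V where "finite V" "B = convex hull V"
    using assms by (auto simp: polytope_def)
  then have "iter_pyr us B = convex hull (set us \<union> V)"
    using False by (simp add: iter_pyr_eq_convex_hull flip: hull_Un_right)
  then show ?thesis
    using \<open>finite V\<close> by (simp add: polytope_convex_hull)
qed (use assms in \<open>simp add: iter_pyr_empty\<close>)

text \<open>Every stage over a polytope is again a polytope, so only the apex conditions remain;
  \<open>drop (Suc i) us\<close> lists the apexes inside the \<open>i\<close>-th one.\<close>

lemma is_iter_pyr_iff:
  assumes "polytope B"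
  shows "is_iter_pyr us B \<longleftrightarrow>
    (\<forall>i<length us. us ! i \<notin> affine hull (iter_pyr (drop (Suc i) us) B))"
proof (induction us)
  case (Cons u us)
  then show ?case
    using assms by (auto simp: polytope_iter_pyr All_less_Suc2)
qed (use assms in simp)

section \<open>Pieces and the regions cut out by coordinate inequalities\<close>

locale simplex_pair =
  fixes v w :: "nat \<Rightarrow> 'a::euclidean_space" and n m k :: nat
  assumes v: "inj_on v {0..n}" "\<not> affine_dependent (v ` {0..n})"
    and w: "inj_on w {0..m}" "\<not> affine_dependent (w ` {0..m})"
    and le: "k \<le> n" "k \<le> m"
    and common: "\<And>i. i \<le> k \<Longrightarrow> w i = v i"
begin

abbreviation apexes :: "('a \<times> 'a) list" where
  "apexes \<equiv> map (\<lambda>i. (v i, v i)) [0..<Suc k]"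

abbreviation base :: "nat set \<Rightarrow> ('a \<times> 'a) set" where
  "base I \<equiv> opp_face v n I \<times> opp_face w m ({0..k} - I)"

abbreviation piece :: "nat set \<Rightarrow> ('a \<times> 'a) set" where
  "piece \<equiv> prod_piece v n w m k"

text \<open>With coordinates quantified existentially, convexity and membership follow by exhibiting
  weights; uniqueness enters only for the strict inequalities in relative interiors.\<close>

definition region :: "nat set \<Rightarrow> ('a \<times> 'a) set" where
  "region I = {(x, y). \<exists>a b. bary_coords v n x a \<and> bary_coords w m y b \<and>
     (\<forall>i\<in>I. a i \<le> b i) \<and> (\<forall>i\<in>{0..k} - I. b i \<le> a i)}"

lemma mem_regionI:
  assumes "bary_coords v n x a" "bary_coords w m y b"
    and "\<forall>i\<in>I. a i \<le> b i" "\<forall>i\<in>{0..k} - I. b i \<le> a i"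
  shows "(x, y) \<in> region I"
  using assms unfolding region_def by blast

lemma convex_region: "convex (region I)"
proof (rule convexI)
  fix z z' and s t :: real
  assume "z \<in> region I" "z' \<in> region I" and st: "0 \<le> s" "0 \<le> t" "s + t = 1"
  then obtain x y a b x' y' a' b' where
    z: "z = (x, y)" "z' = (x', y')" "bary_coords v n x a" "bary_coords v n x' a'"
      "bary_coords w m y b" "bary_coords w m y' b'"
    and le: "\<forall>i\<in>I. a i \<le> b i" "\<forall>i\<in>{0..k} - I. b i \<le> a i"
      "\<forall>i\<in>I. a' i \<le> b' i" "\<forall>i\<in>{0..k} - I. b' i \<le> a' i"
    unfolding region_def by blast
  have "bary_coords v n (s *\<^sub>R x + t *\<^sub>R x') (\<lambda>i. s * a i + t * a' i)"
    "bary_coords w m (s *\<^sub>R y + t *\<^sub>R y') (\<lambda>i. s * b i + t * b' i)"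
    using z st by (auto intro: bary_coords_convex_combination)
  moreover have "\<forall>i\<in>I. s * a i + t * a' i \<le> s * b i + t * b' i"
    "\<forall>i\<in>{0..k} - I. s * b i + t * b' i \<le> s * a i + t * a' i"
    using le st by (auto intro!: add_mono mult_left_mono)
  ultimately show "s *\<^sub>R z + t *\<^sub>R z' \<in> region I"
    unfolding region_def z(1,2) by auto
qed

lemma apex_mem_region:
  assumes "i \<le> k"
  shows "(v i, v i) \<in> region I"
  using assms le common [of i] bary_coords_vertex [of i n v] bary_coords_vertex [of i m w]
  by (intro mem_regionI) auto

text \<open>A coordinate that vanishes in one factor is bounded by the nonnegative one in the other.
  The bound \<open>k\<close> on \<open>I\<close> keeps these indices within both simplices.\<close>

lemma base_subset_region:
  assumes "I \<subseteq> {0..k}"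
  shows "base I \<subseteq> region I"
proof clarify
  fix x y assume "x \<in> opp_face v n I" "y \<in> opp_face w m ({0..k} - I)"
  then obtain a b where ab: "bary_coords v n x a" "bary_coords w m y b"
    "\<forall>i\<in>I. a i = 0" "\<forall>i\<in>{0..k} - I. b i = 0"
    by (auto simp: mem_opp_face_iff)
  moreover have "\<forall>i\<in>I. 0 \<le> b i" "\<forall>i\<in>{0..k} - I. 0 \<le> a i"
    using ab(1,2) assms le by (auto simp: bary_coords_def)
  ultimately show "(x, y) \<in> region I"
    by (intro mem_regionI [OF ab(1,2)]) auto
qed

lemma convex_base: "convex (base I)"
  by (simp add: convex_Times convex_opp_face)

lemma piece_subset_region:
  assumes "I \<subseteq> {0..k}"
  shows "piece I \<subseteq> region I"
  unfolding prod_piece_def using assms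
  by (intro iter_pyr_subset convex_region convex_base base_subset_region)
    (auto intro: apex_mem_region)

text \<open>Split off the common weights \<open>c\<close>. What remains of \<open>a\<close> and of
  \<open>b\<close> has the same total \<open>r\<close>, because both sum to 1, so the two remainders
  together are \<open>r\<close> times one base point \<open>(p, q)\<close>.\<close>

lemma region_subset_piece:
  assumes "I \<subseteq> {0..k}" "base I \<noteq> {}"
  shows "region I \<subseteq> piece I"
proof clarify
  fix x y assume "(x, y) \<in> region I"
  then obtain a b where a: "bary_coords v n x a" and b: "bary_coords w m y b"
    and ab: "\<forall>i\<in>I. a i \<le> b i" "\<forall>i\<in>{0..k} - I. b i \<le> a i"
    unfolding region_def by blast
  \<comment> \<open>Zero beyond \<open>k\<close>, so that sums of \<open>c\<close> over
    \<open>{0..n}\<close>, \<open>{0..m}\<close> and \<open>{0..k}\<close> agree.\<close>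
  define c where "c i = (if i \<le> k then min (a i) (b i) else 0)" for i
  define r where "r = 1 - sum c {0..k}"
  have c0: "0 \<le> c i" for i
    using a b le by (auto simp: c_def bary_coords_def)
  have sum_c: "sum (\<lambda>i. c i *\<^sub>R u i) {0..N} = sum (\<lambda>i. c i *\<^sub>R u i) {0..k}"
    "sum c {0..N} = sum c {0..k}" if "k \<le> N" for N and u :: "nat \<Rightarrow> 'a"
    by (rule sum.mono_neutral_right; use that in \<open>auto simp: c_def\<close>)+
  have "0 \<le> a i - c i" if "i \<le> n" for i
    using a that by (auto simp: c_def bary_coords_def)
  moreover have "a i - c i = 0" if "i \<in> I" for i
    using that ab assms by (auto simp: c_def)
  ultimately obtain p where p: "p \<in> opp_face v n I"
      "(\<Sum>i=0..n. (a i - c i) *\<^sub>R v i) = sum (\<lambda>i. a i - c i) {0..n} *\<^sub>R p"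
    using weights_scaled_opp_face [of v n I "\<lambda>i. a i - c i"] assms(2) by auto
  have "0 \<le> b i - c i" if "i \<le> m" for i
    using b that by (auto simp: c_def bary_coords_def)
  moreover have "b i - c i = 0" if "i \<in> {0..k} - I" for i
    using that ab assms by (auto simp: c_def)
  ultimately obtain q where q: "q \<in> opp_face w m ({0..k} - I)"
      "(\<Sum>i=0..m. (b i - c i) *\<^sub>R w i) = sum (\<lambda>i. b i - c i) {0..m} *\<^sub>R q"
    using weights_scaled_opp_face [of w m "{0..k} - I" "\<lambda>i. b i - c i"] assms(2) by auto
  have sum_ac: "sum (\<lambda>i. a i - c i) {0..n} = r"
    using a le by (simp add: sum_subtractf r_def sum_c [OF le(1)] bary_coords_def)
  have x: "x = (\<Sum>i=0..k. c i *\<^sub>R v i) + r *\<^sub>R p"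
    using a p(2) [unfolded sum_ac]
    by (auto simp: scaleR_left_diff_distrib sum_subtractf sum_c [OF le(1)] bary_coords_def diff_eq_eq)
  have "(\<Sum>i=0..k. c i *\<^sub>R w i) = (\<Sum>i=0..k. c i *\<^sub>R v i)"
    by (simp add: common)
  moreover have sum_bc: "sum (\<lambda>i. b i - c i) {0..m} = r"
    using b le by (simp add: sum_subtractf r_def sum_c [OF le(2)] bary_coords_def)
  ultimately have y: "y = (\<Sum>i=0..k. c i *\<^sub>R v i) + r *\<^sub>R q"
    using b q(2) [unfolded sum_bc]
    by (auto simp: scaleR_left_diff_distrib sum_subtractf sum_c [OF le(2)] bary_coords_def diff_eq_eq)
  have "0 \<le> sum (\<lambda>i. a i - c i) {0..n}"
    by (rule sum_nonneg) (use a in \<open>auto simp: c_def bary_coords_def\<close>)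
  then have "0 \<le> r"
    using sum_ac by simp
  \<comment> \<open>The extra index \<open>Suc k\<close> carries the base point, which makes apexes
    and base point one convex combination.\<close>
  let ?c = "\<lambda>i. if i = Suc k then r else c i"
  let ?u = "\<lambda>i. if i = Suc k then (p, q) else (v i, v i)"
  have "piece I = convex hull (set apexes \<union> base I)"
    unfolding prod_piece_def by (rule iter_pyr_eq_convex_hull) (use assms(2) convex_base in auto)
  moreover have "(\<Sum>i\<in>{0..Suc k}. ?c i *\<^sub>R ?u i) \<in> convex hull (set apexes \<union> base I)"
  proof (rule convex_sum)
    show "sum ?c {0..Suc k} = 1"
      by (simp add: r_def)
    show "?u i \<in> convex hull (set apexes \<union> base I)" if "i \<in> {0..Suc k}" for i
      using that p(1) q(1) by (intro hull_inc) (auto simp del: upt_Suc)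
  qed (use c0 \<open>0 \<le> r\<close> in auto)
  moreover have "(\<Sum>i\<in>{0..Suc k}. ?c i *\<^sub>R ?u i) = (x, y)"
    by (simp add: x y prod_eq_iff fst_sum snd_sum)
  ultimately show "(x, y) \<in> piece I" by simp
qed

section \<open>Covering the product by nonempty pieces\<close>

lemma region_subset_Times: "region I \<subseteq> (convex hull (v ` {0..n})) \<times> (convex hull (w ` {0..m}))"
  \<comment> \<open>With empty index set, \<open>opp_face\<close> is the whole simplex.\<close>
  using mem_opp_face_iff [of _ v n "{}"] mem_opp_face_iff [of _ w m "{}"]
  by (auto simp: region_def opp_face_def)

text \<open>These are the exceptional index sets behind \<open>count_defect\<close>: a face is empty
  only if all vertices of its simplex are common and all are removed.\<close>

lemma base_eq_empty_iff:
  assumes "I \<subseteq> {0..k}"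
  shows "base I = {} \<longleftrightarrow> n = k \<and> I = {0..k} \<or> m = k \<and> I = {}"
proof -
  have "{0..n} \<subseteq> I \<longleftrightarrow> n = k \<and> I = {0..k}"
  proof
    assume "{0..n} \<subseteq> I"
    then have "{0..n} \<subseteq> {0..k}" using assms by (rule order_trans)
    then have "n = k" using le by simp
    then show "n = k \<and> I = {0..k}" using \<open>{0..n} \<subseteq> I\<close> assms by simp
  qed simp
  moreover have "{0..m} \<subseteq> {0..k} - I \<longleftrightarrow> m = k \<and> I = {}"
  proof
    assume sub: "{0..m} \<subseteq> {0..k} - I"
    then have "{0..m} \<subseteq> {0..k}" by blast
    then have "m = k" using le by simp
    then show "m = k \<and> I = {}" using sub assms by blast
  qed simp
  ultimately show ?thesis
    by (simp add: opp_face_eq_empty_iff)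
qed

lemma piece_eq_empty_iff: "piece I = {} \<longleftrightarrow> base I = {}"
proof (cases "base I = {}")
  case False
  then have "piece I = convex hull (set apexes \<union> base I)"
    unfolding prod_piece_def by (intro iter_pyr_eq_convex_hull convex_base)
  then show ?thesis using False by simp
qed (simp only: prod_piece_def iter_pyr_empty)

text \<open>Choose \<open>I\<close> by comparing coordinates. If its base is empty, one coordinate
  vector has its whole mass 1 on \<open>{0..k}\<close> and is dominated there by the other, whose
  mass there is at most 1; so they agree on \<open>{0..k}\<close>. The point then lies in every
  region, and any \<open>J\<close> with nonempty base serves.\<close>

lemma Times_subset_pieces:
  assumes "\<not> (n = 0 \<and> m = 0)"
  shows "(convex hull (v ` {0..n})) \<times> (convex hull (w ` {0..m})) \<subseteq> (\<Union>I\<in>Pow {0..k}. piece I)"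
proof clarify
  fix x y assume "x \<in> convex hull (v ` {0..n})" "y \<in> convex hull (w ` {0..m})"
  then obtain a b where a: "bary_coords v n x a" and b: "bary_coords w m y b"
    using mem_opp_face_iff [of _ v n "{}"] mem_opp_face_iff [of _ w m "{}"]
    by (auto simp: opp_face_def)
  define I where "I = {i\<in>{0..k}. a i \<le> b i}"
  have I: "I \<subseteq> {0..k}" by (auto simp: I_def)
  show "(x, y) \<in> (\<Union>I\<in>Pow {0..k}. piece I)"
  proof (cases "base I = {}")
    case False
    have "(x, y) \<in> region I"
      using a b by (intro mem_regionI) (auto simp: I_def)
    then show ?thesis
      using region_subset_piece [OF I False] I by blast
  next
    case True
    have "\<forall>i\<in>{0..k}. a i = b i"
    proof (cases "n = k \<and> I = {0..k}")
      case True
      then have le_ab: "a i \<le> b i" if "i \<in> {0..k}" for i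
        using that unfolding I_def by blast
      have "sum b {0..k} \<le> sum b {0..m}"
        using b le by (intro sum_mono2) (auto simp: bary_coords_def)
      then have "sum b {0..k} \<le> sum a {0..k}"
        using a b True by (simp add: bary_coords_def)
      then have "sum a {0..k} = sum b {0..k}"
        using sum_mono [of "{0..k}" a b] le_ab by force
      then show ?thesis
        using sum_mono_inv [of a "{0..k}" b] le_ab by auto
    next
      case False
      then have "m = k" "I = {}"
        using True base_eq_empty_iff [OF I] by auto
      then have le_ab: "b i \<le> a i" if "i \<in> {0..k}" for i
        using that unfolding I_def by force
      have "sum a {0..k} \<le> sum a {0..n}"
        using a le by (intro sum_mono2) (auto simp: bary_coords_def)
      then have "sum a {0..k} \<le> sum b {0..k}"
        using a b \<open>m = k\<close> by (simp add: bary_coords_def)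
      then have "sum b {0..k} = sum a {0..k}"
        using sum_mono [of "{0..k}" b a] le_ab by force
      then show ?thesis
        using sum_mono_inv [of b "{0..k}" a] le_ab by fastforce
    qed
    then have mem: "(x, y) \<in> region J" if "J \<subseteq> {0..k}" for J
      using a b that by (intro mem_regionI) auto
    \<comment> \<open>If \<open>n = m = k\<close>, then \<open>k > 0\<close>, so \<open>{0}\<close>
      is neither empty nor all of \<open>{0..k}\<close>.\<close>
    define J where "J = (if n \<noteq> k then {0..k} else if m \<noteq> k then {} else {0})"
    have J: "J \<subseteq> {0..k}" by (simp add: J_def)
    \<comment> \<open>The first disjunction excludes \<open>J = {0..k}\<close> when
      \<open>n = k\<close>, the second \<open>J = {}\<close> when \<open>m = k\<close>.\<close>
    have "k \<notin> J \<or> n \<noteq> k" "0 \<in> J \<or> m \<noteq> k"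
      using assms by (auto simp: J_def)
    then have "base J \<noteq> {}"
      using base_eq_empty_iff [OF J] by auto
    then show ?thesis
      using region_subset_piece [OF J] mem [OF J] J by blast
  qed
qed

section \<open>Strict inequalities and disjoint relative interiors\<close>

text \<open>The witness is a base point \<open>(x, w i)\<close>: its \<open>i\<close>-th coordinates
  are 0 in the first factor and 1 in the second.\<close>

lemma piece_diff_positive:
  assumes "I \<subseteq> {0..k}" "i \<in> I" "piece I \<noteq> {}"
  obtains e a b where "e \<in> piece I" "bary_coords v n (fst e) a" "bary_coords w m (snd e) b"
    "a i < b i"
proof -
  have ne: "base I \<noteq> {}"
    using assms piece_eq_empty_iff by blast
  then obtain x where x: "x \<in> opp_face v n I" by blast
  then obtain a where a: "bary_coords v n x a" "\<forall>i\<in>I. a i = 0"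
    by (auto simp: mem_opp_face_iff)
  have i: "i \<le> m" "i \<notin> {0..k} - I"
    using assms le by auto
  then have "w i \<in> opp_face w m ({0..k} - I)"
    unfolding opp_face_def by (intro hull_inc) auto
  then have "(x, w i) \<in> piece I"
    using x base_subset_region [OF assms(1)] region_subset_piece [OF assms(1) ne] by blast
  then show ?thesis
    using a i assms(2) bary_coords_vertex [of i m w]
    by (intro that [of "(x, w i)" a "\<lambda>j. if j = i then 1 else 0"]) auto
qed

text \<open>The difference \<open>b i - a i\<close> is affine, nonnegative on the piece and positive
  at some \<open>e\<close>. From a relative interior point \<open>z\<close> the segment from
  \<open>e\<close> extends beyond \<open>z\<close> within the piece, so \<open>z\<close> is a convex
  combination with positive weight at \<open>e\<close>.\<close>

lemma rel_interior_piece_diff_positive: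
  assumes I: "I \<subseteq> {0..k}" "i \<in> I" and z: "z \<in> rel_interior (piece I)"
    and a: "bary_coords v n (fst z) a" and b: "bary_coords w m (snd z) b"
  shows "a i < b i"
proof (rule ccontr)
  assume nless: "\<not> a i < b i"
  have "convex (piece I)"
    by (simp add: prod_piece_def convex_iter_pyr convex_base del: upt_Suc)
  moreover have "piece I \<noteq> {}"
    using z rel_interior_subset by blast
  then obtain e a' b' where e: "e \<in> piece I" "bary_coords v n (fst e) a'"
    "bary_coords w m (snd e) b'" "a' i < b' i"
    using piece_diff_positive [OF I] by blast
  ultimately obtain t where t: "t > 1" "(1 - t) *\<^sub>R e + t *\<^sub>R z \<in> piece I"
    using convex_rel_interior_if [OF _ z] hull_inc [OF e(1)] by (metis order_refl)
  define z' where "z' = (1 - t) *\<^sub>R e + t *\<^sub>R z"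
  obtain a'' b'' where z': "bary_coords v n (fst z') a''" "bary_coords w m (snd z') b''"
    "a'' i \<le> b'' i"
    using t(2) piece_subset_region [OF I(1)] I(2) unfolding region_def z'_def [symmetric] by fastforce
  \<comment> \<open>Solving the equation of \<open>z'\<close> for \<open>z\<close> gives weight
    \<open>1 / t\<close> to \<open>z'\<close>; since \<open>t > 1\<close>, the weight of
    \<open>e\<close> is positive.\<close>
  let ?s = "1 / t"
  have s: "0 \<le> ?s" "0 \<le> 1 - ?s" "?s + (1 - ?s) = 1"
    using t(1) by auto
  have "?s *\<^sub>R z' + (1 - ?s) *\<^sub>R e = (?s * (1 - t) + (1 - ?s)) *\<^sub>R e + (?s * t) *\<^sub>R z"
    by (simp add: z'_def scaleR_right_distrib scaleR_left_distrib)
  also have "\<dots> = z"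
    using t(1) by (simp add: field_simps)
  finally have zeq: "z = ?s *\<^sub>R z' + (1 - ?s) *\<^sub>R e" by simp
  have "i \<le> n" "i \<le> m" using I le by auto
  have "fst z = ?s *\<^sub>R fst z' + (1 - ?s) *\<^sub>R fst e"
    by (subst zeq) (simp only: fst_add fst_scaleR)
  then have "a i = ?s * a'' i + (1 - ?s) * a' i"
    using bary_coords_unique [OF v a _ \<open>i \<le> n\<close>]
      bary_coords_convex_combination [OF z'(1) e(2) s] by simp
  moreover have "snd z = ?s *\<^sub>R snd z' + (1 - ?s) *\<^sub>R snd e"
    by (subst zeq) (simp only: snd_add snd_scaleR)
  then have "b i = ?s * b'' i + (1 - ?s) * b' i"
    using bary_coords_unique [OF w b _ \<open>i \<le> m\<close>]
      bary_coords_convex_combination [OF z'(2) e(3) s] by simp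
  moreover have "?s * a'' i \<le> ?s * b'' i"
    using s(1) z'(3) by (rule mult_left_mono [rotated])
  moreover have "(1 - ?s) * a' i < (1 - ?s) * b' i"
    using t(1) e(4) by (intro mult_strict_left_mono) auto
  ultimately show False
    using nless by linarith
qed

text \<open>Distinct index sets differ in an \<open>i\<close> in exactly one of them. There the
  strict \<open>a i < b i\<close> of one relative interior contradicts \<open>b i \<le> a i\<close>
  on the other piece.\<close>

lemma disjoint_rel_interior_pieces:
  "disjoint_family_on (\<lambda>I. rel_interior (piece I)) (Pow {0..k})"
proof -
  have *: "rel_interior (piece I) \<inter> rel_interior (piece J) = {}"
    if I: "I \<subseteq> {0..k}" and J: "J \<subseteq> {0..k}" and i: "i \<in> I" "i \<notin> J" for I J i
  proof (rule equals0I)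
    fix z assume "z \<in> rel_interior (piece I) \<inter> rel_interior (piece J)"
    then have z: "z \<in> rel_interior (piece I)" "z \<in> region J"
      using rel_interior_subset piece_subset_region [OF J] by blast+
    then obtain a b where "bary_coords v n (fst z) a" "bary_coords w m (snd z) b"
      "\<forall>i\<in>{0..k} - J. b i \<le> a i"
      unfolding region_def by auto
    then show False
      using rel_interior_piece_diff_positive [OF I i(1) z(1)] i I by force
  qed
  show ?thesis
    unfolding disjoint_family_on_def
  proof (intro ballI impI)
    fix I J assume "I \<in> Pow {0..k}" "J \<in> Pow {0..k}" "I \<noteq> J"
    then consider i where "i \<in> I" "i \<notin> J" | i where "i \<in> J" "i \<notin> I" by blast
    then show "rel_interior (piece I) \<inter> rel_interior (piece J) = {}"
      using *[of I J] *[of J I] \<open>I \<in> _\<close> \<open>J \<in> _\<close> by cases (auto simp: Int_commute)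
  qed
qed

section \<open>Apex conditions and nonsingular bases\<close>

lemma vertex_notin_affine_hull_others:
  fixes u :: "nat \<Rightarrow> 'b::real_vector"
  assumes "inj_on u {0..N}" "\<not> affine_dependent (u ` {0..N})" "j \<le> N"
  shows "u j \<notin> affine hull (u ` ({0..N} - {j}))"
proof -
  have "u ` {0..N} - {u j} = u ` ({0..N} - {j})"
    using assms by (auto simp: inj_on_def)
  then show ?thesis
    using assms unfolding affine_dependent_def by (metis atLeastAtMost_iff image_eqI zero_le)
qed

text \<open>If \<open>j \<in> I\<close>, then \<open>v j\<close> spans neither the first factor of
  the base nor the first entry of any later apex, so independence of \<open>v\<close> keeps it out
  of the first projection. Otherwise \<open>j\<close> lies in the complement of \<open>I\<close>,
  and the second projection serves.\<close>

lemma is_iter_pyr_pieces: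
  assumes "I \<subseteq> {0..k}"
  shows "is_iter_pyr apexes (base I)"
proof -
  have "polytope (base I)"
    by (simp add: polytope_Times polytope_opp_face)
  show ?thesis
    unfolding is_iter_pyr_iff [OF \<open>polytope (base I)\<close>]
  proof (intro allI impI)
    fix j assume "j < length apexes"
    then have j: "j \<le> k" by simp
    let ?us = "drop (Suc j) apexes"
    have us: "?us = map (\<lambda>i. (v i, v i)) [Suc j..<Suc k]"
      by (simp add: drop_map del: upt_Suc)
    have apex: "apexes ! j = (v j, v j)"
      using j by (simp del: upt_Suc)
    let ?V = "affine hull (v ` ({0..n} - {j}))" and ?W = "affine hull (w ` ({0..m} - {j}))"
    show "apexes ! j \<notin> affine hull (iter_pyr ?us (base I))"
    proof (cases "j \<in> I")
      case True
      have "opp_face v n I \<subseteq> ?V"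
        unfolding opp_face_def using True
        by (intro order_trans [OF convex_hull_subset_affine_hull] hull_mono) auto
      moreover have "set ?us \<subseteq> ?V \<times> UNIV"
        unfolding us using le by (auto simp del: upt_Suc intro!: hull_inc)
      ultimately have "iter_pyr ?us (base I) \<subseteq> ?V \<times> UNIV"
        by (intro iter_pyr_subset convex_base convex_Times affine_imp_convex) auto
      then have "affine hull (iter_pyr ?us (base I)) \<subseteq> ?V \<times> UNIV"
        by (intro hull_minimal affine_Times) auto
      then show ?thesis
        using vertex_notin_affine_hull_others [OF v, of j] j le unfolding apex by auto
    next
      case False
      have "opp_face w m ({0..k} - I) \<subseteq> ?W"
        unfolding opp_face_def using False j
        by (intro order_trans [OF convex_hull_subset_affine_hull] hull_mono) auto
      moreover have "set ?us \<subseteq> UNIV \<times> ?W"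
        \<comment> \<open>Second entries \<open>v i\<close> of the apexes are read as the common
          vertices \<open>w i\<close>.\<close>
        unfolding us using le by (auto simp del: upt_Suc simp flip: common intro!: hull_inc)
      ultimately have "iter_pyr ?us (base I) \<subseteq> UNIV \<times> ?W"
        by (intro iter_pyr_subset convex_base convex_Times affine_imp_convex) auto
      then have "affine hull (iter_pyr ?us (base I)) \<subseteq> UNIV \<times> ?W"
        by (intro hull_minimal affine_Times) auto
      then show ?thesis
        using vertex_notin_affine_hull_others [OF w, of j] j le common [of j] unfolding apex by auto
    qed
  qed
qed

text \<open>Each \<open>i \<le> k\<close> is removed from one of the two factors, and a removed
  vertex is not in the hull of the others.\<close>

lemma nonsingular_base:
  assumes "I \<subseteq> {0..k}"
  shows "nonsingular_face (singular_vertices v k)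
    ((convex hull (v ` {0..n})) \<times> (convex hull (w ` {0..m}))) (base I)"
proof -
  have notin: "u j \<notin> opp_face u N J"
    if "inj_on u {0..N}" "\<not> affine_dependent (u ` {0..N})" "j \<le> N" "j \<in> J"
    for u :: "nat \<Rightarrow> 'a" and N j J
  proof -
    have "opp_face u N J \<subseteq> affine hull (u ` ({0..N} - {j}))"
      unfolding opp_face_def using that
      by (intro order_trans [OF convex_hull_subset_affine_hull] hull_mono) auto
    then show ?thesis
      using vertex_notin_affine_hull_others [OF that(1-3)] by blast
  qed
  have "opp_face v n I face_of convex hull (v ` {0..n})"
    unfolding face_of_convex_hull_affine_independent [OF v(2)]
    by (rule exI [of _ "v ` ({0..n} - I)"]) (auto simp: opp_face_def)
  moreover have "opp_face w m ({0..k} - I) face_of convex hull (w ` {0..m})"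
    unfolding face_of_convex_hull_affine_independent [OF w(2)]
    by (rule exI [of _ "w ` ({0..m} - ({0..k} - I))"]) (auto simp: opp_face_def)
  moreover have "(v i, v i) \<notin> base I" if "i \<le> k" for i
    using that le notin [OF v, of i I] notin [OF w, of i "{0..k} - I"] common [of i] by auto
  ultimately show ?thesis
    by (auto simp: nonsingular_face_def singular_vertices_def intro: face_of_Times)
qed

section \<open>Counting the nonempty pieces\<close>

text \<open>Counting sets reduces to counting index sets: a nonempty convex piece has nonempty
  relative interior, so disjointness makes \<open>piece\<close> injective on them.\<close>

lemma card_nonempty_pieces:
  assumes "\<not> (n = 0 \<and> m = 0)"
  shows "card {piece I | I. I \<in> Pow {0..k} \<and> piece I \<noteq> {}} = 2 ^ (k + 1) - count_defect n m k"
proof -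
  \<comment> \<open>The index sets with empty base; as \<open>0 \<in> {0..k}\<close>, the two
    candidates are distinct.\<close>
  define E where "E = (if n = k then {{0..k}} else {}) \<union> (if m = k then {{}} else {})"
  let ?A = "Pow {0..k} - E"
  have A: "I \<in> Pow {0..k} \<and> piece I \<noteq> {} \<longleftrightarrow> I \<in> ?A" for I
    using base_eq_empty_iff [of I] by (auto simp: piece_eq_empty_iff E_def)
  have "inj_on piece ?A"
  proof (rule inj_onI)
    fix I J assume I: "I \<in> ?A" and J: "J \<in> ?A" and eq: "piece I = piece J"
    have "convex (piece I)"
      by (simp add: prod_piece_def convex_iter_pyr convex_base del: upt_Suc)
    moreover have "piece I \<noteq> {}"
      using I A by blast
    ultimately have "rel_interior (piece I) \<noteq> {}"
      by (simp only: rel_interior_eq_empty not_False_eq_True)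
    moreover have "I \<noteq> J \<Longrightarrow> rel_interior (piece I) \<inter> rel_interior (piece J) = {}"
      using I J by (intro disjoint_family_onD [OF disjoint_rel_interior_pieces]) auto
    ultimately show "I = J"
      using eq by auto
  qed
  then have "card (piece ` ?A) = card ?A" by (rule card_image)
  also have "\<dots> = card (Pow {0..k}) - card E"
    by (rule card_Diff_subset) (auto simp: E_def)
  also have "\<dots> = 2 ^ (k + 1) - count_defect n m k"
    using le by (auto simp: card_Pow E_def count_defect_def)
  also have "piece ` ?A = {piece I | I. I \<in> Pow {0..k} \<and> piece I \<noteq> {}}"
    by (simp only: A) blast
  finally show ?thesis .
qed

end

section \<open>From simplices to independent vertices, and the decomposition\<close>

text \<open>A simplex is the hull of some independent \<open>C\<close> with \<open>n + 1\<close>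
  points. These are extreme points, hence among the \<open>v i\<close>, and cardinality forces
  equality and injectivity.\<close>

lemma simplex_vertices_affine_independent:
  fixes v :: "nat \<Rightarrow> 'a::euclidean_space"
  assumes "int n simplex (convex hull (v ` {0..n}))"
  shows "inj_on v {0..n}" "\<not> affine_dependent (v ` {0..n})"
proof -
  obtain C where C: "\<not> affine_dependent C" "int (card C) = int n + 1"
    "convex hull (v ` {0..n}) = convex hull C"
    using assms by (auto simp: simplex_def)
  have "C \<subseteq> v ` {0..n}"
    using C extreme_point_of_convex_hull_affine_independent [OF C(1)]
    by (metis extreme_point_of_convex_hull subsetI)
  moreover have "card (v ` {0..n}) \<le> card C"
    using card_image_le [of "{0..n}" v] C(2) by simp
  ultimately have eq: "C = v ` {0..n}"
    by (intro card_seteq) auto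
  then show "\<not> affine_dependent (v ` {0..n})" using C by simp
  show "inj_on v {0..n}"
    using C(2) eq by (intro eq_card_imp_inj_on) auto
qed

theorem theorem6p1:
  fixes v w :: "nat \<Rightarrow> real ^ 'd"
    and S T :: "(real ^ 'd) set"
    and n m k :: nat
  assumes S: "S = convex hull (v ` {0..n})" "int n simplex S"
    and T: "T = convex hull (w ` {0..m})" "int m simplex T"
    and not_both_zero: "\<not> (n = 0 \<and> m = 0)"
    and k: "k \<le> min n m"
    and common: "\<And>i. i \<in> {0..k} \<Longrightarrow> v i = w i"
    and inter: "S \<inter> T = convex hull (v ` {0..k})"
  shows "decomposition (S \<times> T) (Pow {0..k}) (prod_piece v n w m k)
    \<and> (\<forall>I \<in> Pow {0..k}.
         is_iter_pyr (map (\<lambda>i. (v i, v i)) [0..<Suc k])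
           (opp_face v n I \<times> opp_face w m ({0..k} - I))
       \<and> nonsingular_face (singular_vertices v k) (S \<times> T)
           (opp_face v n I \<times> opp_face w m ({0..k} - I)))
    \<and> card {prod_piece v n w m k I | I. I \<in> Pow {0..k} \<and> prod_piece v n w m k I \<noteq> {}}
        = 2 ^ (k + 1) - count_defect n m k"
proof -
  interpret simplex_pair v w n m k
    using simplex_vertices_affine_independent [of n v] simplex_vertices_affine_independent [of m w]
      S T k common by unfold_locales auto
  have "S \<times> T = (\<Union>I\<in>Pow {0..k}. piece I)"
    using Times_subset_pieces [OF not_both_zero] piece_subset_region region_subset_Times
    unfolding S(1) T(1) by blast
  then show ?thesis
    using disjoint_rel_interior_pieces is_iter_pyr_pieces nonsingular_base
      card_nonempty_pieces [OF not_both_zero]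
    unfolding decomposition_def S(1) T(1) by auto
qed

end
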